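(* Let $\theta>0$ and $\phi=1/(1+\theta)<1$, and let $A$ be the distribution function on $[0,\infty)$ associated with the classical risk process perturbed by diffusion. Let $k\in(0,1)$, let $\overline K_0(u)=k$ for all $u\ge0$, and define recursively for $n\ge1$ $$\overline K_n(u)=\frac1{1+\theta}\left(\overline A(u)+\int_0^u\overline K_{n-1}(u-x)\,dA(x)\right),\qquad u\ge0.$$ Then for all $u\ge0$, $$\overline K_n(u)=\begin{cases}\phi-(1-k)\,\phi\,A(u), & n=1,\\[2mm] \phi-(1-k)\,\phi^n A^{*n}(u)-(1-\phi)\displaystyle\sum_{i=1}^{n-1}\phi^i A^{*i}(u), & n\ge2.\end{cases}$$
   Context: The setting is the surplus process $U(t)=u+ct-S(t)+\sigma B(t)$, where $c>0$, $\sigma>0$, $D=\sigma^2/2$, $S$ is a compound Poisson process with intensity $\lambda>0$ and positive claim sizes with distribution function $F$ and finite mean $\mu$, $B$ is an independent standard Wiener process, and $c=\lambda(1+\theta)\mu$ (so $\phi=\lambda\mu/c$). $A=H_1*H_2$, i.e. $A(u)=\int_0^u H_1(u-t)\,dH_2(t)$, where $H_1(u)=1-e^{-(c/D)u}$ and $H_2(u)=\frac1\mu\int_0^u(1-F(z))\,dz$ for $u\ge0$; thus $A$ is a continuous distribution function with a density and $A(0)=0$. Write $\overline A=1-A$, and $A^{*i}$ for the $i$-fold convolution of $A$ with itself ($A^{*1}=A$). *)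

theory Defs
  imports "HOL-Probability.Probability"
begin

(* The Stieltjes convolution (G * H)(u) = int_0^u G(u - t) dH(t) of distribution functions
   vanishing on the negative half-line. The range is the closed interval, so a jump of H at 0
   is counted, and the value is 0 for u < 0. The library's interval_measure H is the
   Lebesgue-Stieltjes measure of H provided H is nondecreasing and right-continuous. *)
definition stieltjes_conv :: "(real \<Rightarrow> real) \<Rightarrow> (real \<Rightarrow> real) \<Rightarrow> real \<Rightarrow> real" where
  "stieltjes_conv G H u = (LINT t:{0..u}|interval_measure H. G (u - t))"

(* Index 0 is the unit of the convolution (point mass at 0); powers from index 1 on start at G. *)
fun conv_power :: "(real \<Rightarrow> real) \<Rightarrow> nat \<Rightarrow> real \<Rightarrow> real" where
  "conv_power G 0 = indicator {0..}"
| "conv_power G (Suc 0) = G"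
| "conv_power G (Suc (Suc i)) = stieltjes_conv (conv_power G (Suc i)) G"

definition H1 :: "real \<Rightarrow> real \<Rightarrow> real \<Rightarrow> real" where
  "H1 c D u = (if u < 0 then 0 else 1 - exp (- (c / D) * u))"

(* The set integral over {0..u} makes this 0 for u < 0. *)
definition H2 :: "(real \<Rightarrow> real) \<Rightarrow> real \<Rightarrow> real \<Rightarrow> real" where
  "H2 F \<mu> u = (1 / \<mu>) * (LBINT z:{0..u}. 1 - F z)"

definition ladder_cdf :: "real \<Rightarrow> real \<Rightarrow> (real \<Rightarrow> real) \<Rightarrow> real \<Rightarrow> real \<Rightarrow> real" where
  "ladder_cdf c D F \<mu> = stieltjes_conv (H1 c D) (H2 F \<mu>)"

end

theory Submission imports Defs begin

text \<open>
  Convolving with \<open>A\<close> shifts \<open>A\<^sup>*\<^sup>i\<close> to \<open>A\<^sup>*\<^sup>i\<^sup>+\<^sup>1\<close>, so the formula follows by induction on \<open>n\<close> once the integrals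
  may be split. This needs every \<open>A\<^sup>*\<^sup>i\<close> to be nondecreasing (hence measurable and bounded on
  compact intervals) and \<open>A\<close> to be continuous, so that its Stieltjes measure gives \<open>[0,u]\<close>
  mass \<open>A(u)\<close>. Continuity is inherited by dominated convergence, first by \<open>H\<^sub>2\<close>, then by
  \<open>A = H\<^sub>1 * H\<^sub>2\<close>.
\<close>

section \<open>Lebesgue integrals with a moving endpoint\<close>

text \<open>Dominated convergence: a convergent sequence of endpoints stays below some
  \<open>M\<close>, so \<open>B\<close> on \<open>{a..M}\<close> dominates every integrand. This
  serves \<open>H2\<close>, whose integrand \<open>1 - F\<close> may have jumps.\<close>

lemma continuous_on_LBINT_Icc:
  fixes g :: "real \<Rightarrow> real"
  assumes g: "g \<in> borel_measurable borel" and bnd: "\<And>x. \<bar>g x\<bar> \<le> B"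
  shows "continuous_on UNIV (\<lambda>u. LBINT z:{a..u}. g z)"
proof (rule continuous_on_sequentiallyI)
  fix u :: "nat \<Rightarrow> real" and v assume lim: "u \<longlonglongrightarrow> v"
  then have "Bseq u"
    by (metis convergentI convergent_imp_Bseq)
  then obtain M where M: "\<And>n. \<bar>u n\<bar> \<le> M"
    by (auto simp: Bseq_def)
  have "0 \<le> B"
    using bnd[of 0] by linarith
  show "(\<lambda>n. LBINT z:{a..u n}. g z) \<longlonglongrightarrow> (LBINT z:{a..v}. g z)"
    unfolding set_lebesgue_integral_def
  proof (rule integral_dominated_convergence[where w = "\<lambda>z. indicator {a..M} z * B"])
    show "integrable lborel (\<lambda>z. indicator {a..M} z * B)"
      by (cases "a \<le> M") (auto intro!: integrable_real_indicator)
    \<comment> \<open>Away from \<open>v\<close> the indicators are eventually constant in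
      \<open>n\<close>. At \<open>z = v\<close> they may oscillate, but a single point is a Lebesgue
      null set.\<close>
    show "AE z in lborel. (\<lambda>n. indicator {a..u n} z *\<^sub>R g z) \<longlonglongrightarrow> indicator {a..v} z *\<^sub>R g z"
      using AE_lborel_singleton[of v]
    proof eventually_elim
      case (elim z)
      consider "z < v" | "v < z"
        using elim by linarith
      then have "\<forall>\<^sub>F n in sequentially. (z \<le> u n) = (z \<le> v)"
      proof cases
        case 1
        show ?thesis
          using order_tendstoD(1)[OF lim 1] by eventually_elim (use 1 in auto)
      next
        case 2
        show ?thesis
          using order_tendstoD(2)[OF lim 2] by eventually_elim (use 2 in auto)
      qed
      then have "\<forall>\<^sub>F n in sequentially. indicator {a..u n} z *\<^sub>R g z = indicator {a..v} z *\<^sub>R g z"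
        by eventually_elim (auto simp: indicator_def)
      then show ?case
        by (rule tendsto_eventually)
    qed
    show "AE z in lborel. norm (indicator {a..u n} z *\<^sub>R g z) \<le> indicator {a..M} z * B" for n
    proof (rule AE_I2)
      fix z :: real
      have "u n \<le> M"
        using M[of n] by linarith
      then show "norm (indicator {a..u n} z *\<^sub>R g z) \<le> indicator {a..M} z * B"
        using bnd[of z] \<open>0 \<le> B\<close> by (auto simp: indicator_def)
    qed
  qed (use g in measurable)
qed

section \<open>Stieltjes convolution\<close>

text \<open>A bounded function on a set of finite mass: monotonicity bounds \<open>G (u - t)\<close>
  by its values at the two ends, and continuity of \<open>H\<close> excludes an atom at
  \<open>a\<close>, so the closed interval has mass \<open>H b - H a\<close>.\<close>

lemma integrable_stieltjes_Icc:
  fixes G H :: "real \<Rightarrow> real"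
  assumes H: "mono H" "continuous_on UNIV H" and G: "mono G"
  shows "set_integrable (interval_measure H) {a..b} (\<lambda>t. G (u - t))"
  unfolding set_integrable_def
proof (rule integrableI_bounded_set_indicator)
  have "emeasure (interval_measure H) {a..b} = ennreal (H b - H a)" if "a \<le> b"
    using emeasure_interval_measure_Icc[OF that, of H] H by (auto simp: mono_def)
  then show "emeasure (interval_measure H) {a..b} < \<infinity>"
    by (cases "a \<le> b") auto
  have [measurable]: "G \<in> borel_measurable borel"
    using G by (rule borel_measurable_mono)
  show "(\<lambda>t. G (u - t)) \<in> borel_measurable (interval_measure H)"
    by measurable
  show "AE t in interval_measure H.
      t \<in> {a..b} \<longrightarrow> norm (G (u - t)) \<le> max \<bar>G (u - a)\<bar> \<bar>G (u - b)\<bar>"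
  proof (intro AE_I2 impI)
    fix t assume "t \<in> {a..b}"
    then have "G (u - b) \<le> G (u - t)" "G (u - t) \<le> G (u - a)"
      by (auto intro!: monoD[OF G])
    then show "norm (G (u - t)) \<le> max \<bar>G (u - a)\<bar> \<bar>G (u - b)\<bar>"
      unfolding real_norm_def by linarith
  qed
qed simp

lemma stieltjes_conv_neg: "u < 0 \<Longrightarrow> stieltjes_conv G H u = 0"
  by (simp add: stieltjes_conv_def set_lebesgue_integral_def)

lemma mono_vanishing_nonneg:
  fixes G :: "real \<Rightarrow> real"
  assumes "mono G" "\<And>x. x < 0 \<Longrightarrow> G x = 0" "0 \<le> x"
  shows "0 \<le> G x"
  using monoD[OF assms(1), of "- 1" x] assms(2)[of "- 1"] assms(3) by simp

text \<open>Past \<open>t = u\<close> the factor \<open>G (u - t)\<close> is zero. A range that no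
  longer depends on \<open>u\<close> allows values at different arguments to be compared under one
  integral.\<close>

lemma stieltjes_conv_extend:
  assumes "\<And>x. x < 0 \<Longrightarrow> G x = 0" "u \<le> M"
  shows "stieltjes_conv G H u = (LINT t:{0..M}|interval_measure H. G (u - t))"
  unfolding stieltjes_conv_def set_lebesgue_integral_def
proof (rule Bochner_Integration.integral_cong[OF refl])
  show "indicator {0..u} t *\<^sub>R G (u - t) = indicator {0..M} t *\<^sub>R G (u - t)" for t
    using assms by (cases "u < t") (auto simp: indicator_def)
qed

lemma mono_stieltjes_conv:
  assumes H: "mono H" "continuous_on UNIV H"
    and G: "mono G" "\<And>x. x < 0 \<Longrightarrow> G x = 0"
  shows "mono (stieltjes_conv G H)"
proof (rule monoI)
  fix u v :: real assume "u \<le> v"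
  have "(LINT t:{0..v}|interval_measure H. G (u - t))
      \<le> (LINT t:{0..v}|interval_measure H. G (v - t))"
    using \<open>u \<le> v\<close> by (intro set_integral_mono integrable_stieltjes_Icc H G monoD[OF G(1)]) auto
  then show "stieltjes_conv G H u \<le> stieltjes_conv G H v"
    using stieltjes_conv_extend[of G, OF G(2) \<open>u \<le> v\<close>] stieltjes_conv_extend[of G, OF G(2) order_refl]
    by simp
qed

text \<open>Over a common range \<open>{0..M}\<close> the argument enters only through the
  integrand, so continuity of \<open>G\<close> gives pointwise convergence.\<close>

lemma continuous_on_stieltjes_conv:
  assumes H: "mono H" "continuous_on UNIV H"
    and G: "mono G" "\<And>x. x < 0 \<Longrightarrow> G x = 0" "continuous_on UNIV G"
  shows "continuous_on UNIV (stieltjes_conv G H)"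
proof (rule continuous_on_sequentiallyI)
  fix u :: "nat \<Rightarrow> real" and v assume lim: "u \<longlonglongrightarrow> v"
  then have "Bseq u"
    by (metis convergentI convergent_imp_Bseq)
  then obtain M where M: "\<And>n. \<bar>u n\<bar> \<le> M"
    by (auto simp: Bseq_def)
  have uM: "u n \<le> M" for n
    using M[of n] by linarith
  have vM: "v \<le> M"
    using lim uM by (intro LIMSEQ_le_const2) auto
  have [measurable]: "G \<in> borel_measurable borel"
    using G(1) by (rule borel_measurable_mono)
  have "(\<lambda>n. LINT t:{0..M}|interval_measure H. G (u n - t))
      \<longlonglongrightarrow> (LINT t:{0..M}|interval_measure H. G (v - t))"
    unfolding set_lebesgue_integral_def
  \<comment> \<open>Since \<open>G\<close> is nondecreasing and nonnegative, moving
    \<open>u n\<close> up to its bound \<open>M\<close> yields a majorant independent of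
    \<open>n\<close>.\<close>
  proof (rule integral_dominated_convergence[where w = "\<lambda>t. indicator {0..M} t *\<^sub>R G (M - t)"])
    show "integrable (interval_measure H) (\<lambda>t. indicator {0..M} t *\<^sub>R G (M - t))"
      using integrable_stieltjes_Icc[OF H G(1)] by (simp add: set_integrable_def)
    show "AE t in interval_measure H.
        (\<lambda>n. indicator {0..M} t *\<^sub>R G (u n - t)) \<longlonglongrightarrow> indicator {0..M} t *\<^sub>R G (v - t)"
      using lim
      by (intro AE_I2 tendsto_intros continuous_on_tendsto_compose[OF G(3)]) auto
    show "AE t in interval_measure H.
        norm (indicator {0..M} t *\<^sub>R G (u n - t)) \<le> indicator {0..M} t *\<^sub>R G (M - t)" for n
    proof (rule AE_I2)
      fix t
      have "G (u n - t) \<le> G (M - t)"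
        using uM[of n] by (intro monoD[OF G(1)]) simp
      moreover have "0 \<le> G (u n - t)"
        using mono_vanishing_nonneg[OF G(1,2)] G(2) by (metis less_eq_real_def not_le)
      ultimately show "norm (indicator {0..M} t *\<^sub>R G (u n - t)) \<le> indicator {0..M} t *\<^sub>R G (M - t)"
        by (auto simp: indicator_def)
    qed
  qed measurable
  then show "(\<lambda>n. stieltjes_conv G H (u n)) \<longlonglongrightarrow> stieltjes_conv G H v"
    using stieltjes_conv_extend[of G _ M, OF G(2)] uM vM by simp
qed

section \<open>Convolution powers\<close>

lemma conv_power_neg:
  assumes "\<And>x. x < 0 \<Longrightarrow> G x = 0" "x < 0"
  shows "conv_power G n x = 0"
  using assms by (cases "(G, n)" rule: conv_power.cases) (auto simp: stieltjes_conv_neg)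

text \<open>Every step integrates against the same continuous \<open>G\<close>, so monotonicity
  passes from one power to the next. Continuity is not claimed for the powers: index 0 jumps at
  0.\<close>

lemma mono_conv_power:
  assumes "mono G" "continuous_on UNIV G" "\<And>x. x < 0 \<Longrightarrow> G x = 0"
  shows "mono (conv_power G n)"
  using assms
proof (induction G n rule: conv_power.induct)
  case (1 G)
  show ?case
    by (auto simp: mono_def indicator_def)
next
  case (3 G i)
  then show ?case
    using mono_stieltjes_conv[of G "conv_power G (Suc i)"] conv_power_neg[of G] by simp
qed simp

section \<open>Regularity of the ladder distribution function\<close>

lemma mono_continuous_H1:
  assumes "0 \<le> c" "0 \<le> D"
  shows "mono (H1 c D)" "continuous_on UNIV (H1 c D)"
proof -
  \<comment> \<open>The exponential formula already vanishes at 0, so truncating the argument there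
    replaces the case distinction.\<close>
  have eq: "H1 c D = (\<lambda>u. 1 - exp (- (c / D) * max 0 u))"
    by (auto simp: H1_def fun_eq_iff max_def)
  show "mono (H1 c D)"
    unfolding eq using assms
    by (intro monoI) (auto intro!: divide_right_mono mult_left_mono)
  show "continuous_on UNIV (H1 c D)"
    unfolding eq by (intro continuous_intros)
qed

text \<open>The tail \<open>1 - F\<close> lies between 0 and 1: boundedness gives continuity of its
  integral, nonnegativity makes the integral grow with the endpoint.\<close>

lemma mono_continuous_H2:
  assumes P: "real_distribution P" and "0 \<le> \<mu>"
  shows "mono (H2 (cdf P) \<mu>)" "continuous_on UNIV (H2 (cdf P) \<mu>)"
proof -
  interpret real_distribution P by fact
  have meas [measurable]: "cdf P \<in> borel_measurable borel"
    by (intro borel_measurable_mono monoI cdf_nondecreasing)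
  have bnd: "\<bar>1 - cdf P z\<bar> \<le> 1" for z
    using cdf_nonneg[of z] cdf_bounded_prob[of z] by simp
  show "continuous_on UNIV (H2 (cdf P) \<mu>)"
    unfolding H2_def by (intro continuous_intros continuous_on_LBINT_Icc[OF _ bnd]) measurable
  have int: "set_integrable lborel {0..u} (\<lambda>z. 1 - cdf P z)" for u
    unfolding set_integrable_def
    using bnd by (intro integrableI_bounded_set_indicator[where B = 1])
      (auto simp: emeasure_lborel_Icc_eq)
  show "mono (H2 (cdf P) \<mu>)"
  proof (rule monoI)
    fix u v :: real assume "u \<le> v"
    then have "(LBINT z:{0..u}. 1 - cdf P z) \<le> (LBINT z:{0..v}. 1 - cdf P z)"
      using int[of u] int[of v] cdf_bounded_prob
      unfolding set_lebesgue_integral_def set_integrable_def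
      by (intro integral_mono) (auto simp: indicator_def)
    then show "H2 (cdf P) \<mu> u \<le> H2 (cdf P) \<mu> v"
      unfolding H2_def using \<open>0 \<le> \<mu>\<close> by (intro mult_left_mono) auto
  qed
qed

lemma mono_continuous_ladder_cdf:
  assumes "real_distribution P" "0 \<le> \<mu>" "0 \<le> c" "0 \<le> D"
  shows "mono (ladder_cdf c D (cdf P) \<mu>)" "continuous_on UNIV (ladder_cdf c D (cdf P) \<mu>)"
  unfolding ladder_cdf_def using assms
  by (auto intro!: mono_stieltjes_conv continuous_on_stieltjes_conv mono_continuous_H1 mono_continuous_H2
      simp: H1_def)

section \<open>Solution of the recursion\<close>

text \<open>Indexing by \<open>Suc n\<close> lets one formula cover both cases: for
  \<open>n = 0\<close> the sum is empty and the power is \<open>A\<close> itself.\<close>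

lemma stieltjes_recursion_solution:
  fixes A :: "real \<Rightarrow> real" and K :: "nat \<Rightarrow> real \<Rightarrow> real"
  assumes A: "mono A" "continuous_on UNIV A" "\<And>x. x < 0 \<Longrightarrow> A x = 0"
    and K_0: "\<And>u. 0 \<le> u \<Longrightarrow> K 0 u = k"
    and K_rec: "\<And>n u. 0 \<le> u \<Longrightarrow>
      K (Suc n) u = \<phi> * ((1 - A u) + (LINT x:{0..u}|interval_measure A. K n (u - x)))"
    and "0 \<le> u"
  shows "K (Suc n) u = \<phi> - (1 - k) * \<phi> ^ Suc n * conv_power A (Suc n) u
      - (1 - \<phi>) * (\<Sum>i=1..n. \<phi> ^ i * conv_power A i u)"
  using \<open>0 \<le> u\<close>
proof (induction n arbitrary: u)
  \<comment> \<open>By continuity \<open>A 0\<close> is the limit from the left, where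
    \<open>A\<close> vanishes. Hence the mass \<open>A u - A 0\<close> of \<open>{0..u}\<close> is
    just \<open>A u\<close>.\<close>
  have "A 0 = 0"
  proof (rule LIMSEQ_unique)
    have "(\<lambda>n. - 1 / real (Suc n)) \<longlonglongrightarrow> 0"
      by real_asymp
    then show "(\<lambda>n. A (- 1 / real (Suc n))) \<longlonglongrightarrow> A 0"
      by (rule continuous_on_tendsto_compose[OF A(2)]) auto
    show "(\<lambda>n. A (- 1 / real (Suc n))) \<longlonglongrightarrow> 0"
      using A(3) by simp
  qed
  have mass: "emeasure (interval_measure A) {0..u} = ennreal (A u)" if "0 \<le> u" for u
    using emeasure_interval_measure_Icc[OF that, of A] A \<open>A 0 = 0\<close> by (auto simp: mono_def)
  have const: "(LINT x:{0..u}|interval_measure A. b) = b * A u" if "0 \<le> u" for b u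
    using mass[OF that] mono_vanishing_nonneg[OF A(1,3) that]
    by (simp add: measure_def set_lebesgue_integral_def)
  {
    case 0
    have "(LINT x:{0..u}|interval_measure A. K 0 (u - x)) = k * A u"
      unfolding const[OF 0, symmetric]
      by (rule set_lebesgue_integral_cong) (auto simp: K_0)
    then show ?case
      using K_rec[OF 0, of 0] by (simp add: algebra_simps)
  next
    case (Suc n)
    let ?M = "interval_measure A"
    have cp_int: "set_integrable ?M {0..u} (\<lambda>x. conv_power A i (u - x))" for i
      by (intro integrable_stieltjes_Icc A mono_conv_power)
    have const_int: "set_integrable ?M {0..u} (\<lambda>x. b)" for b :: real
      using integrable_stieltjes_Icc[OF A(1,2), of "\<lambda>_. b"] by (simp add: mono_def)
    have sum_int: "set_integrable ?M {0..u} (\<lambda>x. \<Sum>i=1..n. \<phi> ^ i * conv_power A i (u - x))"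
      using cp_int unfolding set_integrable_def
      by (simp add: sum_distrib_left mult.left_commute)
    have shift: "(LINT x:{0..u}|?M. conv_power A (Suc i) (u - x)) = conv_power A (Suc (Suc i)) u" for i
      by (simp add: stieltjes_conv_def)
    have sum_eq: "(LINT x:{0..u}|?M. (\<Sum>i=1..n. \<phi> ^ i * conv_power A i (u - x)))
        = (\<Sum>i=1..n. \<phi> ^ i * conv_power A (Suc i) u)"
    proof -
      have "(LINT x:{0..u}|?M. (\<Sum>i=1..n. \<phi> ^ i * conv_power A i (u - x)))
          = (\<Sum>i=1..n. LINT x:{0..u}|?M. \<phi> ^ i * conv_power A i (u - x))"
        using cp_int unfolding set_lebesgue_integral_def set_integrable_def
        by (simp add: sum_distrib_left Bochner_Integration.integral_sum mult.left_commute)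
      also have "\<dots> = (\<Sum>i=1..n. \<phi> ^ i * conv_power A (Suc i) u)"
      proof (rule sum.cong[OF refl])
        fix i assume "i \<in> {1..n}"
        \<comment> \<open>\<open>shift\<close> rests on the recursive equation of
          \<open>conv_power\<close>, which raises indices from 1 on; the sum starts exactly
          there.\<close>
        then obtain j where "i = Suc j"
          by (cases i) auto
        then show "(LINT x:{0..u}|?M. \<phi> ^ i * conv_power A i (u - x)) = \<phi> ^ i * conv_power A (Suc i) u"
          using shift[of j] by simp
      qed
      finally show ?thesis .
    qed
    \<comment> \<open>For \<open>x\<close> in \<open>{0..u}\<close> the argument
      \<open>u - x\<close> is nonnegative, so the induction hypothesis may be inserted under the
      integral.\<close>
    have "(LINT x:{0..u}|?M. K (Suc n) (u - x))
        = (LINT x:{0..u}|?M. \<phi> - ((1 - k) * \<phi> ^ Suc n) * conv_power A (Suc n) (u - x)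
            - (1 - \<phi>) * (\<Sum>i=1..n. \<phi> ^ i * conv_power A i (u - x)))"
      by (rule set_lebesgue_integral_cong) (auto simp: Suc.IH)
    also have "\<dots> = (LINT x:{0..u}|?M. \<phi>)
        - (LINT x:{0..u}|?M. ((1 - k) * \<phi> ^ Suc n) * conv_power A (Suc n) (u - x))
        - (LINT x:{0..u}|?M. (1 - \<phi>) * (\<Sum>i=1..n. \<phi> ^ i * conv_power A i (u - x)))"
      by (subst set_integral_diff(2); (subst set_integral_diff(2))?)
        (intro refl set_integral_diff(1) set_integrable_mult_right const_int cp_int sum_int)+
    also have "\<dots> = \<phi> * A u - (1 - k) * \<phi> ^ Suc n * conv_power A (Suc (Suc n)) u
        - (1 - \<phi>) * (\<Sum>i=1..n. \<phi> ^ i * conv_power A (Suc i) u)"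
      unfolding set_integral_mult_right shift sum_eq const[OF Suc.prems] ..
    finally have step: "(LINT x:{0..u}|?M. K (Suc n) (u - x)) = \<dots>" .
    \<comment> \<open>Multiplied by \<open>\<phi>\<close>, the integrated sum yields all terms of
      the new sum but the first. That one comes from
      \<open>\<phi> * (1 - A u) + \<phi> * (\<phi> * A u)\<close>, which equals
      \<open>\<phi> - (1 - \<phi>) * \<phi> * A u\<close>.\<close>
    have "(\<Sum>i=1..Suc n. \<phi> ^ i * conv_power A i u)
        = \<phi> * A u + \<phi> * (\<Sum>i=1..n. \<phi> ^ i * conv_power A (Suc i) u)"
      by (simp add: sum.atLeast_Suc_atMost sum.shift_bounds_cl_Suc_ivl sum_distrib_left mult.assoc
          del: sum.cl_ivl_Suc)
    then show ?case
      unfolding K_rec[OF Suc.prems, of "Suc n"] step by (simp add: algebra_simps)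
  }
qed

theorem lemma1:
  fixes P :: "real measure"
    and lam \<theta> \<sigma> \<mu> c D \<phi> k :: real
    and A :: "real \<Rightarrow> real"
    and K :: "nat \<Rightarrow> real \<Rightarrow> real"
  assumes claim_distr: "real_distribution P"
    and claims_pos: "AE x in P. 0 < x"
    and finite_mean: "integrable P (\<lambda>x. x)"
    and mu: "\<mu> = (LINT x|P. x)"
    and lambda: "0 < lam"
    and theta: "0 < \<theta>"
    and sigma: "0 < \<sigma>"
    and D: "D = \<sigma>\<^sup>2 / 2"
    and c: "c = lam * (1 + \<theta>) * \<mu>"
    and phi: "\<phi> = 1 / (1 + \<theta>)"
    and A: "A = ladder_cdf c D (cdf P) \<mu>"
    and k: "0 < k" "k < 1"
    and K_0: "\<And>u. 0 \<le> u \<Longrightarrow> K 0 u = k"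
    and K_rec: "\<And>n u. 1 \<le> n \<Longrightarrow> 0 \<le> u \<Longrightarrow>
      K n u = 1 / (1 + \<theta>) * ((1 - A u) + (LINT x:{0..u}|interval_measure A. K (n - 1) (u - x)))"
  shows "\<forall>n\<ge>1. \<forall>u\<ge>0. K n u =
    (if n = 1 then \<phi> - (1 - k) * \<phi> * A u
     else \<phi> - (1 - k) * \<phi> ^ n * conv_power A n u
            - (1 - \<phi>) * (\<Sum>i=1..n-1. \<phi> ^ i * conv_power A i u))"
proof (intro allI impI)
  fix n :: nat and u :: real assume n: "1 \<le> n" and u: "0 \<le> u"
  \<comment> \<open>Almost surely positive claims have a nonnegative mean, which makes
    \<open>c\<close> nonnegative too; these signs make \<open>H1\<close> and \<open>H2\<close>
    nondecreasing.\<close>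
  have "0 \<le> \<mu>"
    unfolding mu using claims_pos by (intro integral_nonneg_AE) (auto elim: eventually_mono)
  moreover have "0 \<le> c"
    unfolding c using lambda theta \<open>0 \<le> \<mu>\<close> by simp
  moreover have "0 \<le> D"
    by (simp add: D)
  ultimately have A_props: "mono A" "continuous_on UNIV A"
    unfolding A using claim_distr by (auto intro!: mono_continuous_ladder_cdf)
  have A_neg: "A x = 0" if "x < 0" for x
    using that by (simp add: A ladder_cdf_def stieltjes_conv_neg)
  have rec: "K (Suc m) v = \<phi> * ((1 - A v) + (LINT x:{0..v}|interval_measure A. K m (v - x)))"
    if "0 \<le> v" for m v
    using K_rec[of "Suc m" v] that by (simp add: phi)
  obtain m where "n = Suc m"
    using n by (cases n) auto
  then show "K n u = (if n = 1 then \<phi> - (1 - k) * \<phi> * A u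
     else \<phi> - (1 - k) * \<phi> ^ n * conv_power A n u
            - (1 - \<phi>) * (\<Sum>i=1..n-1. \<phi> ^ i * conv_power A i u))"
    using stieltjes_recursion_solution[where K = K and k = k, OF A_props A_neg K_0 rec u, of m]
    by (cases m) auto
qed

end
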